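(* Let $Q=(-1,1)^3$. For polynomials $u(\lambda_1,\lambda_2,\lambda_3)$ of degree at most $W$ in each variable separately put $$\mathcal B(u)=\|u\|^2_{H^2(Q)}=\int_Q\sum_{|\alpha|\le2}|D^\alpha_\lambda u|^2\,d\lambda,$$ $$\mathcal C(u)=\int_Q\big(u_{\lambda_1\lambda_1}^2+u_{\lambda_2\lambda_2}^2+u_{\lambda_3\lambda_3}^2+u_{\lambda_1}^2+u_{\lambda_2}^2+u_{\lambda_3}^2+u^2\big)\,d\lambda.$$ Then the quadratic forms $\mathcal B$ and $\mathcal C$ are spectrally equivalent, i.e. there exist constants $c_1,c_2>0$ independent of $W$ such that $c_1\,\mathcal B(u)\le\mathcal C(u)\le c_2\,\mathcal B(u)$ for all such $u$.
   Context: $D^\alpha_\lambda=\partial_{\lambda_1}^{\alpha_1}\partial_{\lambda_2}^{\alpha_2}\partial_{\lambda_3}^{\alpha_3}$ for a multi-index $\alpha$, $|\alpha|=\alpha_1+\alpha_2+\alpha_3$. *)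

theory Defs
  imports "HOL-Analysis.Analysis"
begin

definition poly_deg_le :: "nat \<Rightarrow> (real^3 \<Rightarrow> real) \<Rightarrow> bool" where
  "poly_deg_le W u \<longleftrightarrow>
     (\<exists>c :: nat \<Rightarrow> nat \<Rightarrow> nat \<Rightarrow> real. \<forall>x.
        u x = (\<Sum>i\<le>W. \<Sum>j\<le>W. \<Sum>k\<le>W. c i j k * (x $ 1) ^ i * (x $ 2) ^ j * (x $ 3) ^ k))"

definition Q :: "(real^3) set" where
  "Q = {x. \<forall>i. -1 < x $ i \<and> x $ i < 1}"

definition partial :: "3 \<Rightarrow> (real^3 \<Rightarrow> real) \<Rightarrow> real^3 \<Rightarrow> real" where
  "partial i u x = deriv (\<lambda>t. u (x + t *\<^sub>R axis i 1)) 0"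

definition D :: "nat \<times> nat \<times> nat \<Rightarrow> (real^3 \<Rightarrow> real) \<Rightarrow> real^3 \<Rightarrow> real" where
  "D = (\<lambda>(a1, a2, a3) u. (partial 1 ^^ a1) ((partial 2 ^^ a2) ((partial 3 ^^ a3) u)))"

definition multi_indices_le :: "nat \<Rightarrow> (nat \<times> nat \<times> nat) set" where
  "multi_indices_le m = {(a1, a2, a3). a1 + a2 + a3 \<le> m}"

lemma finite_multi_indices_le: "finite (multi_indices_le m)"
  by (rule finite_subset[of _ "{..m} \<times> {..m} \<times> {..m}"]) (auto simp: multi_indices_le_def)

(* The Lebesgue integral below returns 0 for a non-integrable function; for polynomial u the
   integrands are polynomials, hence integrable on the bounded set Q. *)
definition form_B :: "(real^3 \<Rightarrow> real) \<Rightarrow> real" where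
  "form_B u = (LINT x:Q|lborel. (\<Sum>\<alpha>\<in>multi_indices_le 2. \<bar>D \<alpha> u x\<bar>\<^sup>2))"

definition form_C :: "(real^3 \<Rightarrow> real) \<Rightarrow> real" where
  "form_C u = (LINT x:Q|lborel.
       (partial 1 (partial 1 u) x)\<^sup>2 + (partial 2 (partial 2 u) x)\<^sup>2 + (partial 3 (partial 3 u) x)\<^sup>2
     + (partial 1 u x)\<^sup>2 + (partial 2 u x)\<^sup>2 + (partial 3 u x)\<^sup>2 + (u x)\<^sup>2)"

end

theory Submission imports Defs begin

text \<open>Only the mixed derivatives have to be bounded. A function on \<open>[-1,1]\<close> is extended to \<open>[-2,2]\<close>
  by the \<open>C\<^sup>1\<close> reflection \<open>f (s + s t) = \<chi> t * (4 f (s (1 - t/2)) - 3 f (s (1 - t)))\<close>, \<open>s = \<plusminus>1\<close>, where the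
  cutoff \<open>\<chi>\<close> vanishes to second order at \<open>t = 1\<close>. The extension is bounded in \<open>L\<^sup>2\<close> and in \<open>H\<^sup>2\<close>. Extending
  \<open>u\<close> in two of the variables and integrating by parts without boundary terms,
  \<open>\<integral> (D\<^sub>1 D\<^sub>2 u)\<^sup>2 = \<integral> (D\<^sub>1\<^sup>2 u) (D\<^sub>2\<^sup>2 u) \<le> (\<integral> (D\<^sub>1\<^sup>2 u)\<^sup>2 + \<integral> (D\<^sub>2\<^sup>2 u)\<^sup>2) / 2\<close>.
  All integrals are quadratic forms in the coefficients of \<open>u\<close> whose kernels are products of
  one-dimensional Gram kernels of monomials, so the one-dimensional estimates are multiplied
  together by means of positive semidefinite kernels (Schur products).\<close>

subsection \<open>Positive semidefinite kernels\<close>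

definition psd :: "('a \<Rightarrow> 'a \<Rightarrow> real) \<Rightarrow> bool" where
  "psd K \<longleftrightarrow> (\<forall>S c. finite S \<longrightarrow> 0 \<le> (\<Sum>p\<in>S. \<Sum>q\<in>S. c p * c q * K p q))"

text \<open>The Schur product theorem is built into the notion: multiplication by such a kernel
  preserves positivity. No factorization of abstract positive kernels is needed, since every
  multiplier used is a sum of integral Gram kernels.\<close>

definition psd_mult :: "('a \<Rightarrow> 'a \<Rightarrow> real) \<Rightarrow> bool" where
  "psd_mult L \<longleftrightarrow> (\<forall>K. psd K \<longrightarrow> psd (\<lambda>p q. K p q * L p q))"

lemma psdI:
  assumes "\<And>S c. finite S \<Longrightarrow> 0 \<le> (\<Sum>p\<in>S. \<Sum>q\<in>S. c p * c q * K p q)"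
  shows "psd K"
  using assms by (auto simp: psd_def)

lemma psdD: "psd K \<Longrightarrow> finite S \<Longrightarrow> 0 \<le> (\<Sum>p\<in>S. \<Sum>q\<in>S. c p * c q * K p q)"
  by (auto simp: psd_def)

lemma psd_add:
  assumes "psd K" "psd L"
  shows "psd (\<lambda>p q. K p q + L p q)"
  unfolding psd_def distrib_left sum.distrib
  by (intro allI impI add_nonneg_nonneg psdD assms)

lemma psd_cmult:
  fixes K :: "'a \<Rightarrow> 'a \<Rightarrow> real"
  assumes "psd K" "0 \<le> a"
  shows "psd (\<lambda>p q. a * K p q)"
proof (rule psdI)
  fix S :: "'a set" and c :: "'a \<Rightarrow> real" assume "finite S"
  have "(\<Sum>p\<in>S. \<Sum>q\<in>S. c p * c q * (a * K p q)) = a * (\<Sum>p\<in>S. \<Sum>q\<in>S. c p * c q * K p q)"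
    by (simp add: sum_distrib_left mult.left_commute)
  with psdD[OF assms(1) \<open>finite S\<close>, of c] assms(2)
  show "0 \<le> (\<Sum>p\<in>S. \<Sum>q\<in>S. c p * c q * (a * K p q))" by simp
qed

lemma sum_mult_comp:
  fixes c :: "'a \<Rightarrow> real" and h :: "'b \<Rightarrow> real" and f :: "'a \<Rightarrow> 'b"
  assumes "finite S"
  shows "(\<Sum>p\<in>S. c p * h (f p)) = (\<Sum>a\<in>f ` S. (\<Sum>p\<in>{p\<in>S. f p = a}. c p) * h a)"
proof -
  have "(\<Sum>p\<in>S. c p * h (f p)) = (\<Sum>a\<in>f ` S. \<Sum>p\<in>{p\<in>S. f p = a}. c p * h (f p))"
    by (rule sum.image_gen[OF assms])
  also have "\<dots> = (\<Sum>a\<in>f ` S. (\<Sum>p\<in>{p\<in>S. f p = a}. c p) * h a)"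
    by (intro sum.cong refl) (simp add: sum_distrib_right)
  finally show ?thesis .
qed

text \<open>Coefficients with the same image under \<open>f\<close> are added up to a test vector on
  the image of \<open>S\<close>. This lifts kernels on exponents to kernels on exponent triples,
  along projections that are not injective.\<close>

lemma psd_pullback:
  fixes K :: "'b \<Rightarrow> 'b \<Rightarrow> real" and f :: "'a \<Rightarrow> 'b"
  assumes "psd K"
  shows "psd (\<lambda>p q. K (f p) (f q))"
proof (rule psdI)
  fix S :: "'a set" and c :: "'a \<Rightarrow> real" assume S: "finite S"
  define b where "b a = (\<Sum>p\<in>{p\<in>S. f p = a}. c p)" for a
  have "(\<Sum>p\<in>S. \<Sum>q\<in>S. c p * c q * K (f p) (f q)) = (\<Sum>p\<in>S. c p * (\<Sum>q\<in>S. c q * K (f p) (f q)))"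
    by (simp add: sum_distrib_left mult.assoc)
  also have "\<dots> = (\<Sum>p\<in>S. c p * (\<Sum>a\<in>f ` S. b a * K (f p) a))"
    unfolding b_def by (subst sum_mult_comp[OF S, of c]) (rule refl)
  also have "\<dots> = (\<Sum>a\<in>f ` S. b a * (\<Sum>a'\<in>f ` S. b a' * K a a'))"
    unfolding b_def by (rule sum_mult_comp[OF S])
  also have "\<dots> = (\<Sum>a\<in>f ` S. \<Sum>a'\<in>f ` S. b a * b a' * K a a')"
    by (simp add: sum_distrib_left mult.assoc)
  also have "\<dots> \<ge> 0" using S by (intro psdD[OF assms]) auto
  finally show "0 \<le> (\<Sum>p\<in>S. \<Sum>q\<in>S. c p * c q * K (f p) (f q))" .
qed

lemma psd_multD: "psd_mult L \<Longrightarrow> psd K \<Longrightarrow> psd (\<lambda>p q. K p q * L p q)"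
  by (auto simp: psd_mult_def)

text \<open>The constant kernel \<open>1\<close> is positive, its quadratic form being the square of
  the sum of the coefficients, and multiplying it by \<open>L\<close> returns
  \<open>L\<close>.\<close>

lemma psd_mult_imp_psd:
  fixes L :: "'a \<Rightarrow> 'a \<Rightarrow> real"
  assumes "psd_mult L"
  shows "psd L"
proof -
  have "psd (\<lambda>p q :: 'a. 1)"
  proof (rule psdI)
    fix S :: "'a set" and c :: "'a \<Rightarrow> real"
    have "(\<Sum>p\<in>S. \<Sum>q\<in>S. c p * c q * 1) = (\<Sum>p\<in>S. c p)\<^sup>2"
      by (simp add: power2_eq_square sum_product)
    thus "0 \<le> (\<Sum>p\<in>S. \<Sum>q\<in>S. c p * c q * 1)" by simp
  qed
  from psd_multD[OF assms this] show ?thesis by simp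
qed

lemma psd_mult_add: "psd_mult K \<Longrightarrow> psd_mult L \<Longrightarrow> psd_mult (\<lambda>p q. K p q + L p q)"
  unfolding psd_mult_def distrib_left by (intro allI impI psd_add) blast+

text \<open>With the sums moved under the integral, the integrand at each \<open>t\<close> is the
  quadratic form of \<open>K\<close> at the vector \<open>c p * g p t\<close>, hence
  nonnegative.\<close>

lemma psd_mult_gram:
  fixes g :: "'a \<Rightarrow> real \<Rightarrow> real"
  assumes g: "\<And>p. continuous_on {a..b} (g p)"
  shows "psd_mult (\<lambda>p q. integral {a..b} (\<lambda>t. g p t * g q t))"
  unfolding psd_mult_def
proof (intro allI impI psdI)
  fix K :: "'a \<Rightarrow> 'a \<Rightarrow> real" and S :: "'a set" and c :: "'a \<Rightarrow> real"
  assume K: "psd K" and S: "finite S"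
  have int: "(\<lambda>t. c p * g p t * (c q * g q t) * K p q) integrable_on {a..b}" for p q
    by (intro integrable_continuous_interval continuous_intros g)
  have int2: "(\<lambda>t. \<Sum>q\<in>S. c p * g p t * (c q * g q t) * K p q) integrable_on {a..b}" for p
    by (intro integrable_sum S int)
  have "0 \<le> integral {a..b} (\<lambda>t. \<Sum>p\<in>S. \<Sum>q\<in>S. c p * g p t * (c q * g q t) * K p q)"
    by (intro integral_nonneg integrable_sum S int psdD[OF K])
  also have "\<dots> = (\<Sum>p\<in>S. \<Sum>q\<in>S. integral {a..b} (\<lambda>t. c p * g p t * (c q * g q t) * K p q))"
    by (simp add: integral_sum[OF S] int int2)
  also have "\<dots> = (\<Sum>p\<in>S. \<Sum>q\<in>S. c p * c q * (K p q * integral {a..b} (\<lambda>t. g p t * g q t)))"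
  proof (intro sum.cong refl)
    fix p q
    have "integral {a..b} (\<lambda>t. c p * g p t * (c q * g q t) * K p q)
        = integral {a..b} (\<lambda>t. (c p * c q * K p q) * (g p t * g q t))"
      by (simp add: algebra_simps)
    thus "integral {a..b} (\<lambda>t. c p * g p t * (c q * g q t) * K p q)
        = c p * c q * (K p q * integral {a..b} (\<lambda>t. g p t * g q t))"
      by (simp add: mult.assoc)
  qed
  finally show "0 \<le> (\<Sum>p\<in>S. \<Sum>q\<in>S. c p * c q * (K p q * integral {a..b} (\<lambda>t. g p t * g q t)))" .
qed

text \<open>Applied to a block kernel on \<open>'a \<times> bool\<close>, positivity on the vectors \<open>(c, -c)\<close>.\<close>

lemma psd_block_diff:
  fixes P :: "'a \<times> bool \<Rightarrow> 'a \<times> bool \<Rightarrow> real"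
  assumes "psd P"
  shows "psd (\<lambda>p q. P (p, True) (q, True) + P (p, False) (q, False)
                  - P (p, True) (q, False) - P (p, False) (q, True))"
proof (rule psdI)
  fix S :: "'a set" and c :: "'a \<Rightarrow> real" assume S: "finite S"
  define d where "d = (\<lambda>(p, e). if e then c p else - c p)"
  have d: "(\<Sum>x\<in>S \<times> UNIV. h x) = (\<Sum>p\<in>S. h (p, True) + h (p, False))" for h :: "'a \<times> bool \<Rightarrow> real"
    by (subst sum.cartesian_product') (simp add: UNIV_bool add.commute)
  have "0 \<le> (\<Sum>x\<in>S \<times> UNIV. \<Sum>y\<in>S \<times> UNIV. d x * d y * P x y)"
    by (intro psdD assms finite_cartesian_product S) auto
  also have "\<dots> = (\<Sum>p\<in>S. \<Sum>q\<in>S. c p * c q * (P (p, True) (q, True) + P (p, False) (q, False)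
                  - P (p, True) (q, False) - P (p, False) (q, True)))"
    unfolding d sum.distrib[symmetric]
    by (intro sum.cong refl) (simp add: d_def distrib_left right_diff_distrib)
  finally show "0 \<le> \<dots>" .
qed

text \<open>The substitution yields the factor \<open>1 / \<bar>m\<bar>\<close> and an image
  interval inside \<open>{-1..1}\<close>, which may be enlarged to \<open>{-1..1}\<close> because
  \<open>g\<close> is nonnegative.\<close>

lemma integral_affine_le:
  fixes g :: "real \<Rightarrow> real"
  assumes g: "continuous_on UNIV g" and nn: "\<And>x. 0 \<le> g x"
    and m: "m \<noteq> 0" and c: "\<bar>c\<bar> \<le> 1" "\<bar>c + m\<bar> \<le> 1"
  shows "integral {0..1} (\<lambda>t. g (m * t + c)) \<le> (1 / \<bar>m\<bar>) * integral {-1..1} g"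
proof -
  \<comment> \<open>For \<open>m < 0\<close> the map reverses orientation, so the endpoints of the
    image are ordered by \<open>min\<close> and \<open>max\<close>.\<close>
  define u v where "u = min c (c + m)" and "v = max c (c + m)"
  have int: "g integrable_on {x..y}" for x y
    by (intro integrable_continuous_interval continuous_on_subset[OF g]) auto
  have "(g has_integral integral {u..v} g) (cbox u v)"
    using int[of u v] by (simp add: integrable_integral)
  from has_integral_affinity[OF this m, of c]
  have "((\<lambda>x. g (m * x + c)) has_integral (1 / \<bar>m\<bar>) * integral {u..v} g)
          ((\<lambda>x. (1 / m) * x + - (c / m)) ` {u..v})" by simp
  also have "(\<lambda>x. (1 / m) * x + - (c / m)) ` {u..v} = {0..1}"
  proof (cases "m > 0")
    case True
    hence uv: "u = c" "v = c + m" by (auto simp: u_def v_def)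
    have "c / m + 1 = (c + m) / m" using m by (simp add: add_divide_distrib)
    with True show ?thesis
      unfolding uv image_affinity_atLeastAtMost by (simp add: add_divide_distrib)
  next
    case False
    hence uv: "u = c + m" "v = c" by (auto simp: u_def v_def)
    from m False show ?thesis
      unfolding uv image_affinity_atLeastAtMost by (simp add: add_divide_distrib)
  qed
  finally have "integral {0..1} (\<lambda>t. g (m * t + c)) = (1 / \<bar>m\<bar>) * integral {u..v} g"
    by (rule integral_unique)
  moreover have "integral {u..v} g \<le> integral {-1..1} g"
    using c nn by (intro integral_subset_le int) (auto simp: u_def v_def)
  ultimately show ?thesis by (simp add: divide_right_mono)
qed

subsection \<open>Extension across the endpoints of an interval\<close>

text \<open>The truncated \<open>i - 1\<close> at \<open>i = 0\<close> is harmless, since the factor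
  \<open>real i\<close> is then 0.\<close>

primrec mono_deriv :: "nat \<Rightarrow> nat \<Rightarrow> real \<Rightarrow> real" where
  "mono_deriv 0 i x = x ^ i"
| "mono_deriv (Suc k) i x = real i * mono_deriv k (i - 1) x"

lemma has_derivative_mono_deriv:
  "(mono_deriv k i has_real_derivative mono_deriv (Suc k) i x) (at x)"
proof (induction k arbitrary: i)
  case 0
  have "((\<lambda>x. x ^ i) has_real_derivative real i * x ^ (i - 1)) (at x)"
    by (auto intro!: derivative_eq_intros)
  thus ?case by simp
next
  case (Suc k)
  have "((\<lambda>x. real i * mono_deriv k (i - 1) x) has_real_derivative
         real i * mono_deriv (Suc k) (i - 1) x) (at x)"
    by (intro DERIV_cmult Suc)
  thus ?case by simp
qed

text \<open>A function \<open>F 0\<close> is bundled with all its derivatives, so that the order of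
  differentiation is an index and no \<open>deriv\<close> has to be evaluated.\<close>

definition deriv_seq :: "(nat \<Rightarrow> real \<Rightarrow> real) \<Rightarrow> bool" where
  "deriv_seq F \<longleftrightarrow> (\<forall>k x. (F k has_real_derivative F (Suc k) x) (at x))"

lemma deriv_seqD: "deriv_seq F \<Longrightarrow> (F k has_real_derivative F (Suc k) x) (at x)"
  by (simp add: deriv_seq_def)

lemma continuous_on_deriv_seq: "deriv_seq F \<Longrightarrow> continuous_on A (F k)"
  by (meson DERIV_continuous continuous_at_imp_continuous_on deriv_seqD)

lemma deriv_seq_mono_deriv: "deriv_seq (\<lambda>k. mono_deriv k i)"
  unfolding deriv_seq_def using has_derivative_mono_deriv by blast

text \<open>The cutoff is the Hermite cubic \<open>1 - 3 * t^2 + 2 * t^3\<close>, with value 1 and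
  slope 0 at \<open>t = 0\<close>, value 0 and slope 0 at \<open>t = 1\<close>.\<close>

definition bump :: "nat \<Rightarrow> real \<Rightarrow> real" where
  "bump k t = (if k = 0 then (1 - t)\<^sup>2 * (1 + 2 * t) else if k = 1 then 6 * t\<^sup>2 - 6 * t else 12 * t - 6)"

text \<open>The \<open>k\<close>-th derivative in \<open>t\<close> of
  \<open>4 * F 0 (s * (1 - t / 2)) - 3 * F 0 (s * (1 - t))\<close>: the chain rule gives
  \<open>(- s / 2) ^ k\<close> and \<open>(- s) ^ k\<close>, and the common power of
  \<open>- s\<close> is factored out.\<close>

definition refl_deriv :: "real \<Rightarrow> nat \<Rightarrow> (nat \<Rightarrow> real \<Rightarrow> real) \<Rightarrow> real \<Rightarrow> real" where
  "refl_deriv s k F t = (- s) ^ k * (4 * (1/2) ^ k * F k (s * (1 - t / 2)) - 3 * F k (s * (1 - t)))"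

text \<open>For \<open>s = \<plusminus>1\<close> and \<open>F k\<close> the \<open>k\<close>-th derivative of a function on \<open>[-1,1]\<close>, this is the
  \<open>k\<close>-th derivative in \<open>t\<close> of its extension at the point \<open>s * (1 + t)\<close>, only for \<open>k \<le> 2\<close>, as is
  \<open>bump k\<close> for the cutoff \<open>bump 0\<close>.
  The weights \<open>4\<close> and \<open>-3\<close> make value and slope match at \<open>t = 0\<close>.\<close>

definition ext_deriv :: "real \<Rightarrow> nat \<Rightarrow> (nat \<Rightarrow> real \<Rightarrow> real) \<Rightarrow> real \<Rightarrow> real" where
  "ext_deriv s k F t = (\<Sum>m\<le>k. real (k choose m) * bump m t * refl_deriv s (k - m) F t)"

lemma ext_deriv_simps:
  "ext_deriv s 0 F t = bump 0 t * refl_deriv s 0 F t"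
  "ext_deriv s (Suc 0) F t = bump 0 t * refl_deriv s 1 F t + bump 1 t * refl_deriv s 0 F t"
  "ext_deriv s 2 F t = bump 0 t * refl_deriv s 2 F t + 2 * bump 1 t * refl_deriv s 1 F t
     + bump 2 t * refl_deriv s 0 F t"
  by (simp_all add: ext_deriv_def numeral_2_eq_2)

lemma has_derivative_bump:
  "(bump 0 has_real_derivative bump 1 t) (at t)"
  "(bump 1 has_real_derivative bump 2 t) (at t)"
proof -
  have "((\<lambda>t. (1 - t)\<^sup>2 * (1 + 2 * t)) has_real_derivative 6 * t\<^sup>2 - 6 * t) (at t)"
    by (auto intro!: derivative_eq_intros simp: power2_eq_square algebra_simps)
  moreover have "((\<lambda>t. 6 * t\<^sup>2 - 6 * t) has_real_derivative 12 * t - 6) (at t)"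
    by (auto intro!: derivative_eq_intros)
  moreover have "bump 0 = (\<lambda>t. (1 - t)\<^sup>2 * (1 + 2 * t))" "bump 1 = (\<lambda>t. 6 * t\<^sup>2 - 6 * t)"
    by (auto simp: bump_def)
  ultimately show "(bump 0 has_real_derivative bump 1 t) (at t)"
    "(bump 1 has_real_derivative bump 2 t) (at t)" by (simp_all add: bump_def)
qed

lemma deriv_seq_refl_deriv:
  assumes F: "deriv_seq F"
  shows "deriv_seq (\<lambda>k. refl_deriv s k F)"
  unfolding deriv_seq_def
proof (intro allI)
  fix k t
  note [derivative_intros] = DERIV_chain2[OF deriv_seqD[OF F]]
  show "(refl_deriv s k F has_real_derivative refl_deriv s (Suc k) F t) (at t)"
    unfolding refl_deriv_def[abs_def]
    by (rule derivative_eq_intros refl | simp)+ (simp add: algebra_simps)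
qed

lemma continuous_on_ext_deriv:
  assumes F: "deriv_seq F"
  shows "continuous_on A (ext_deriv s k F)"
proof -
  have "continuous_on A (bump m)" for m
    unfolding bump_def[abs_def] by (cases "m = 0"; cases "m = 1") (auto intro!: continuous_intros)
  moreover have "continuous_on A (refl_deriv s m F)" for m
    by (rule continuous_on_deriv_seq[OF deriv_seq_refl_deriv[OF F]])
  ultimately show ?thesis
    unfolding ext_deriv_def[abs_def] by (intro continuous_intros)
qed

lemma has_derivative_ext_deriv:
  assumes F: "deriv_seq F"
  shows "(ext_deriv s 0 F has_real_derivative ext_deriv s 1 F t) (at t)"
    and "(ext_deriv s 1 F has_real_derivative ext_deriv s 2 F t) (at t)"
proof -
  note R = deriv_seqD[OF deriv_seq_refl_deriv[OF F]]
  have "((\<lambda>t. bump 0 t * refl_deriv s 0 F t) has_real_derivative ext_deriv s 1 F t) (at t)"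
    by (rule derivative_eq_intros has_derivative_bump R refl)+ (simp add: ext_deriv_simps)
  thus "(ext_deriv s 0 F has_real_derivative ext_deriv s 1 F t) (at t)"
    by (simp add: ext_deriv_simps[abs_def])
  have "((\<lambda>t. bump 0 t * refl_deriv s 1 F t + bump 1 t * refl_deriv s 0 F t)
      has_real_derivative ext_deriv s 2 F t) (at t)"
    by (rule derivative_eq_intros has_derivative_bump R refl)+
       (simp add: ext_deriv_simps flip: numeral_2_eq_2)
  thus "(ext_deriv s 1 F has_real_derivative ext_deriv s 2 F t) (at t)"
    by (simp add: ext_deriv_simps[abs_def])
qed

text \<open>At \<open>t = 0\<close> the cutoff has value 1 and slope 0, so only the reflection is
  seen: \<open>4 - 3 = 1\<close> for the value and \<open>- 2 * s + 3 * s = s\<close> for the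
  slope.\<close>

lemma ext_deriv_ends:
  "ext_deriv s 0 F 0 = F 0 s" "ext_deriv s 1 F 0 = s * F 1 s" "ext_deriv s 0 F 1 = 0"
  by (simp_all add: ext_deriv_simps bump_def refl_deriv_def algebra_simps)

lemma integral_by_parts_deriv:
  fixes f f' f'' g g' :: "real \<Rightarrow> real"
  assumes "a \<le> b"
    and f: "\<And>x. (f' has_real_derivative f'' x) (at x)"
    and g: "\<And>x. (g has_real_derivative g' x) (at x)"
    and c: "continuous_on {a..b} f''" "continuous_on {a..b} g'"
  shows "integral {a..b} (\<lambda>x. f' x * g' x)
       = f' b * g b - f' a * g a - integral {a..b} (\<lambda>x. f'' x * g x)"
proof -
  have cont: "continuous_on {a..b} f'" "continuous_on {a..b} g"
    using f g by (meson DERIV_continuous continuous_at_imp_continuous_on)+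
  have "((\<lambda>x. f'' x * g x + f' x * g' x) has_integral f' b * g b - f' a * g a) {a..b}"
  proof (rule fundamental_theorem_of_calculus[OF \<open>a \<le> b\<close>])
    fix x
    have "((\<lambda>x. f' x * g x) has_real_derivative f'' x * g x + f' x * g' x) (at x)"
      by (rule derivative_eq_intros f g refl)+ simp
    thus "((\<lambda>x. f' x * g x) has_vector_derivative f'' x * g x + f' x * g' x) (at x within {a..b})"
      using has_field_derivative_at_within has_real_derivative_iff_has_vector_derivative by blast
  qed
  hence "integral {a..b} (\<lambda>x. f'' x * g x + f' x * g' x) = f' b * g b - f' a * g a"
    by (rule integral_unique)
  moreover have "integral {a..b} (\<lambda>x. f'' x * g x + f' x * g' x)
      = integral {a..b} (\<lambda>x. f'' x * g x) + integral {a..b} (\<lambda>x. f' x * g' x)"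
    by (intro integral_add integrable_continuous_interval continuous_intros c cont)
  ultimately show ?thesis by simp
qed

section \<open>One-dimensional Gram kernels of monomials and of their extensions\<close>

definition gram :: "nat \<Rightarrow> nat \<Rightarrow> nat \<Rightarrow> nat \<Rightarrow> real" where
  "gram k l i j = integral {-1..1} (\<lambda>x. mono_deriv k i x * mono_deriv l j x)"

text \<open>The contribution of the extension beyond the endpoint \<open>s\<close>, at distance
  \<open>t\<close>. Differentiating in \<open>t\<close> instead of the original variable costs a
  factor \<open>s ^ (k + l)\<close>, which is 1 for \<open>s = \<plusminus>1\<close> and
  \<open>k + l\<close> even.\<close>

definition outer_gram :: "real \<Rightarrow> nat \<Rightarrow> nat \<Rightarrow> nat \<Rightarrow> nat \<Rightarrow> real" where
  "outer_gram s k l i j = integral {0..1}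
     (\<lambda>t. ext_deriv s k (\<lambda>k. mono_deriv k i) t * ext_deriv s l (\<lambda>k. mono_deriv k j) t)"

text \<open>For \<open>k + l\<close> even, the inner product on \<open>[-2,2]\<close> of the
  \<open>k\<close>-th and \<open>l\<close>-th derivatives of the extended monomials.\<close>

definition ext_gram :: "nat \<Rightarrow> nat \<Rightarrow> nat \<Rightarrow> nat \<Rightarrow> real" where
  "ext_gram k l i j = gram k l i j + (outer_gram 1 k l i j + outer_gram (-1) k l i j)"

lemma ext_gram_commute: "ext_gram k l i j = ext_gram l k j i"
  by (simp add: ext_gram_def gram_def outer_gram_def mult.commute)

lemma continuous_on_mono_deriv: "continuous_on A (mono_deriv k i)"
  by (rule continuous_on_deriv_seq[OF deriv_seq_mono_deriv])

text \<open>The boundary terms at \<open>\<plusminus>1\<close> cancel and those at \<open>\<plusminus>2\<close> vanish.\<close>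

lemma ext_gram_by_parts: "ext_gram 1 1 i j = - ext_gram 2 0 i j"
proof -
  let ?F = "\<lambda>i k. mono_deriv k i"
  note D = has_derivative_mono_deriv
  have 1: "gram 1 1 i j = ?F i 1 1 * ?F j 0 1 - ?F i 1 (-1) * ?F j 0 (-1) - gram 2 0 i j"
    unfolding gram_def
    by (rule integral_by_parts_deriv)
       (use D[of 1] D[of 0] in
        \<open>simp_all add: numeral_2_eq_2 continuous_on_mono_deriv del: mono_deriv.simps\<close>)
  have 2: "outer_gram s 1 1 i j = - (s * ?F i 1 s * ?F j 0 s) - outer_gram s 2 0 i j" for s
  proof -
    note E = has_derivative_ext_deriv[OF deriv_seq_mono_deriv]
    have "outer_gram s 1 1 i j = ext_deriv s 1 (?F i) 1 * ext_deriv s 0 (?F j) 1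
        - ext_deriv s 1 (?F i) 0 * ext_deriv s 0 (?F j) 0 - outer_gram s 2 0 i j"
      unfolding outer_gram_def
      by (rule integral_by_parts_deriv) (use E in \<open>simp_all add: continuous_on_ext_deriv[OF deriv_seq_mono_deriv]\<close>)
    thus ?thesis by (simp only: ext_deriv_ends)
  qed
  show ?thesis unfolding ext_gram_def 1 2 by simp
qed

text \<open>The order \<open>\<kappa> p\<close> may vary with the index along with the exponent
  \<open>\<nu> p\<close>, so that kernels mixing different derivatives can be covered.\<close>

lemma psd_mult_gram_kernel:
  "psd_mult (\<lambda>p q. gram (\<kappa> p) (\<kappa> q) (\<nu> p) (\<nu> q))"
  unfolding gram_def by (rule psd_mult_gram) (rule continuous_on_mono_deriv)

lemma psd_mult_outer_gram:
  "psd_mult (\<lambda>p q. outer_gram s (\<kappa> p) (\<kappa> q) (\<nu> p) (\<nu> q))"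
  unfolding outer_gram_def
  by (rule psd_mult_gram) (rule continuous_on_ext_deriv[OF deriv_seq_mono_deriv])

lemma psd_mult_ext_gram:
  "psd_mult (\<lambda>p q. ext_gram (\<kappa> p) (\<kappa> q) (\<nu> p) (\<nu> q))"
  unfolding ext_gram_def
  by (intro psd_mult_add psd_mult_gram_kernel psd_mult_outer_gram)

lemma psd_gram_le_ext_gram: "psd (\<lambda>i j. ext_gram k k i j - gram k k i j)"
  using psd_mult_imp_psd[OF psd_mult_add[OF psd_mult_outer_gram psd_mult_outer_gram],
      of 1 "\<lambda>_. k" "\<lambda>i. i" "-1" "\<lambda>_. k" "\<lambda>i. i"]
  by (simp add: ext_gram_def)

subsection \<open>Bounds for the extension\<close>

text \<open>Expanding the square under the integral. This is the bridge from integral estimates to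
  kernel inequalities.\<close>

lemma gram_quadratic:
  fixes g :: "'a \<Rightarrow> real \<Rightarrow> real"
  assumes S: "finite S" and g: "\<And>p. continuous_on {a..b} (g p)"
  shows "(\<Sum>p\<in>S. \<Sum>q\<in>S. c p * c q * integral {a..b} (\<lambda>t. g p t * g q t))
       = integral {a..b} (\<lambda>t. (\<Sum>p\<in>S. c p * g p t)\<^sup>2)"
proof -
  have int: "(\<lambda>t. c p * c q * (g p t * g q t)) integrable_on {a..b}" for p q
    by (intro integrable_continuous_interval continuous_intros g)
  have "(\<Sum>p\<in>S. \<Sum>q\<in>S. c p * c q * integral {a..b} (\<lambda>t. g p t * g q t))
      = (\<Sum>p\<in>S. \<Sum>q\<in>S. integral {a..b} (\<lambda>t. c p * c q * (g p t * g q t)))"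
    by simp
  also have "\<dots> = integral {a..b} (\<lambda>t. \<Sum>p\<in>S. \<Sum>q\<in>S. c p * c q * (g p t * g q t))"
    by (simp only: integral_sum[OF S] int integrable_sum[OF S])
  also have "\<dots> = integral {a..b} (\<lambda>t. (\<Sum>p\<in>S. c p * g p t)\<^sup>2)"
    by (simp add: power2_eq_square sum_product mult_ac)
  finally show ?thesis .
qed

lemma square_add_le: "(x + y)\<^sup>2 \<le> 2 * x\<^sup>2 + 2 * (y::real)\<^sup>2"
  using zero_le_power2[of "x - y"] by (simp add: power2_eq_square algebra_simps)

lemma square_add3_le: "(x + y + z)\<^sup>2 \<le> 3 * (x\<^sup>2 + y\<^sup>2 + (z::real)\<^sup>2)"
  using zero_le_power2[of "x - y"] zero_le_power2[of "x - z"] zero_le_power2[of "y - z"]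
  by (simp add: power2_eq_square algebra_simps)

text \<open>Splitting the square turns the weights 4 and 3 into \<open>2 * 16 = 32\<close> and
  \<open>2 * 9 = 18\<close>; substitution with slopes of modulus 1/2 and 1 doubles the first, and
  \<open>64 + 18 = 82\<close>. Powers of 1/2 are bounded by 1, so the constant is uniform in
  \<open>k\<close>.\<close>

lemma integral_refl_deriv_le:
  assumes F: "deriv_seq F" and s: "\<bar>s\<bar> = 1"
  shows "integral {0..1} (\<lambda>t. (refl_deriv s k F t)\<^sup>2) \<le> 82 * integral {-1..1} (\<lambda>x. (F k x)\<^sup>2)"
proof -
  have FC [continuous_intros]: "continuous_on A (\<lambda>t. F k (h t))" if "continuous_on A h" for A h
    using continuous_on_compose2[OF continuous_on_deriv_seq[OF F] that subset_UNIV] .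
  let ?I = "integral {-1..1} (\<lambda>x. (F k x)\<^sup>2)"
  have I0: "0 \<le> ?I"
    by (intro integral_nonneg integrable_continuous_interval continuous_intros) auto
  have s': "s = 1 \<or> s = -1" using s by linarith
  have "refl_deriv s k F t ^ 2 \<le> 32 * (F k ((- s / 2) * t + s))\<^sup>2 + 18 * (F k ((- s) * t + s))\<^sup>2" for t
  proof -
    let ?a = "F k ((- s / 2) * t + s)" and ?b = "F k ((- s) * t + s)"
    have "((- s) ^ k)\<^sup>2 = 1"
      using s' by (auto simp: power2_eq_square simp flip: power_mult_distrib)
    hence "(refl_deriv s k F t)\<^sup>2 = (4 * (1/2) ^ k * ?a + - 3 * ?b)\<^sup>2"
      unfolding refl_deriv_def power_mult_distrib[of "(- s) ^ k"] by (simp add: algebra_simps)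
    also have "\<dots> \<le> 2 * (4 * (1/2) ^ k * ?a)\<^sup>2 + 2 * (- 3 * ?b)\<^sup>2"
      by (rule square_add_le)
    also have "\<dots> = 32 * ((1/2) ^ k)\<^sup>2 * ?a\<^sup>2 + 18 * ?b\<^sup>2"
      by (simp add: power_mult_distrib)
    also have "\<dots> \<le> 32 * 1 * ?a\<^sup>2 + 18 * ?b\<^sup>2"
      by (intro add_mono mult_right_mono mult_left_mono power_le_one) auto
    finally show ?thesis by simp
  qed
  hence "integral {0..1} (\<lambda>t. (refl_deriv s k F t)\<^sup>2)
      \<le> integral {0..1} (\<lambda>t. 32 * (F k ((- s / 2) * t + s))\<^sup>2 + 18 * (F k ((- s) * t + s))\<^sup>2)"
    by (intro integral_le integrable_continuous_interval continuous_intros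
        continuous_on_deriv_seq[OF deriv_seq_refl_deriv[OF F]]) auto
  also have "\<dots> = 32 * integral {0..1} (\<lambda>t. (F k ((- s / 2) * t + s))\<^sup>2)
      + 18 * integral {0..1} (\<lambda>t. (F k ((- s) * t + s))\<^sup>2)"
    by (subst integral_add) (auto intro!: integrable_continuous_interval continuous_intros)
  also have "\<dots> \<le> 32 * (1 / \<bar>- s / 2\<bar> * ?I) + 18 * (1 / \<bar>- s\<bar> * ?I)"
    using s' by (intro add_mono mult_left_mono integral_affine_le) (auto intro!: continuous_intros)
  also have "\<dots> = 82 * ?I" using s by simp
  finally show ?thesis .
qed

lemma bump_bounds:
  assumes "t \<in> {0..1}"
  shows "\<bar>bump 0 t\<bar> \<le> 1" "\<bar>2 * bump 1 t\<bar> \<le> 6" "\<bar>bump 2 t\<bar> \<le> 6"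
proof -
  have "1 - bump 0 t = t\<^sup>2 * (3 - 2 * t)"
    by (simp add: bump_def power2_eq_square algebra_simps)
  moreover have "0 \<le> t\<^sup>2 * (3 - 2 * t)" "0 \<le> bump 0 t" using assms by (auto simp: bump_def)
  ultimately show "\<bar>bump 0 t\<bar> \<le> 1" by linarith
  have "0 \<le> t\<^sup>2" "t\<^sup>2 \<le> t" "t \<le> 1" using assms by (auto simp: power2_eq_square mult_left_le)
  moreover have "t - t\<^sup>2 = 1/4 - (t - 1/2)\<^sup>2" by (simp add: power2_eq_square algebra_simps)
  hence "t - t\<^sup>2 \<le> 1/4" by simp
  ultimately show "\<bar>2 * bump 1 t\<bar> \<le> 6" by (simp add: bump_def)
  show "\<bar>bump 2 t\<bar> \<le> 6" using assms by (auto simp: bump_def)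
qed

lemma square_mult_le:
  fixes x y :: real
  assumes "\<bar>x\<bar> \<le> a"
  shows "(x * y)\<^sup>2 \<le> a\<^sup>2 * y\<^sup>2"
  using power_mono[OF assms abs_ge_zero, of 2]
  by (simp add: power_mult_distrib mult_right_mono)

lemma integral_ext_deriv_0_le:
  assumes F: "deriv_seq F" and s: "\<bar>s\<bar> = 1"
  shows "integral {0..1} (\<lambda>t. (ext_deriv s 0 F t)\<^sup>2) \<le> 82 * integral {-1..1} (\<lambda>x. (F 0 x)\<^sup>2)"
proof -
  have "integral {0..1} (\<lambda>t. (ext_deriv s 0 F t)\<^sup>2) \<le> integral {0..1} (\<lambda>t. (refl_deriv s 0 F t)\<^sup>2)"
  proof (intro integral_le integrable_continuous_interval continuous_intros
      continuous_on_ext_deriv[OF F] continuous_on_deriv_seq[OF deriv_seq_refl_deriv[OF F]])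
    fix t :: real assume "t \<in> {0..1}"
    from square_mult_le[OF bump_bounds(1)[OF this]]
    show "(ext_deriv s 0 F t)\<^sup>2 \<le> (refl_deriv s 0 F t)\<^sup>2" by (simp add: ext_deriv_simps)
  qed
  also have "\<dots> \<le> 82 * integral {-1..1} (\<lambda>x. (F 0 x)\<^sup>2)"
    by (rule integral_refl_deriv_le[OF F s])
  finally show ?thesis .
qed

text \<open>Derivatives falling on the cutoff produce lower-order terms, hence all three norms on
  the right. Three summands with cutoff bounds 1, 6, 6 give at most \<open>3 * 36 = 108\<close>, and
  \<open>108 * 82 = 8856\<close> is below 9000.\<close>

lemma integral_ext_deriv_2_le:
  assumes F: "deriv_seq F" and s: "\<bar>s\<bar> = 1"
  shows "integral {0..1} (\<lambda>t. (ext_deriv s 2 F t)\<^sup>2)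
       \<le> 9000 * (integral {-1..1} (\<lambda>x. (F 0 x)\<^sup>2) + integral {-1..1} (\<lambda>x. (F 1 x)\<^sup>2)
               + integral {-1..1} (\<lambda>x. (F 2 x)\<^sup>2))"
proof -
  let ?R = "\<lambda>k t. (refl_deriv s k F t)\<^sup>2"
  note cont = integrable_continuous_interval continuous_intros
      continuous_on_ext_deriv[OF F] continuous_on_deriv_seq[OF deriv_seq_refl_deriv[OF F]]
  have F0: "0 \<le> integral {-1..1} (\<lambda>x. (F k x)\<^sup>2)" for k
    by (intro integral_nonneg cont continuous_on_deriv_seq[OF F]) auto
  have "integral {0..1} (\<lambda>t. (ext_deriv s 2 F t)\<^sup>2)
      \<le> integral {0..1} (\<lambda>t. 108 * ?R 0 t + 108 * ?R 1 t + 108 * ?R 2 t)"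
  proof (intro integral_le cont)
    fix t :: real assume t: "t \<in> {0..1}"
    have "(ext_deriv s 2 F t)\<^sup>2 \<le> 3 * ((bump 0 t * refl_deriv s 2 F t)\<^sup>2
        + (2 * bump 1 t * refl_deriv s 1 F t)\<^sup>2 + (bump 2 t * refl_deriv s 0 F t)\<^sup>2)"
      unfolding ext_deriv_simps by (rule square_add3_le)
    also have "\<dots> \<le> 3 * (1\<^sup>2 * ?R 2 t + 6\<^sup>2 * ?R 1 t + 6\<^sup>2 * ?R 0 t)"
      by (intro mult_left_mono add_mono square_mult_le bump_bounds[OF t]) simp
    also have "\<dots> \<le> 108 * ?R 0 t + 108 * ?R 1 t + 108 * ?R 2 t" by simp
    finally show "(ext_deriv s 2 F t)\<^sup>2 \<le> 108 * ?R 0 t + 108 * ?R 1 t + 108 * ?R 2 t" .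
  qed
  also have "\<dots> = 108 * integral {0..1} (?R 0) + 108 * integral {0..1} (?R 1)
      + 108 * integral {0..1} (?R 2)"
  proof -
    have R: "(\<lambda>t. 108 * ?R k t) integrable_on {0..1}" for k by (intro cont)
    show ?thesis by (simp only: integral_add R integrable_add integral_mult_right)
  qed
  finally show ?thesis
    using integral_refl_deriv_le[OF F s, of 0] integral_refl_deriv_le[OF F s, of 1]
      integral_refl_deriv_le[OF F s, of 2] F0[of 0] F0[of 1] F0[of 2]
    unfolding distrib_left by linarith
qed

lemma deriv_seq_sum:
  assumes "\<And>i. i \<in> S \<Longrightarrow> deriv_seq (F i)"
  shows "deriv_seq (\<lambda>k x. \<Sum>i\<in>S. c i * F i k x)"
  unfolding deriv_seq_def
  by (intro allI DERIV_sum DERIV_cmult deriv_seqD assms)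

lemma ext_deriv_sum:
  "ext_deriv s k (\<lambda>k x. \<Sum>i\<in>S. c i * F i k x) t = (\<Sum>i\<in>S. c i * ext_deriv s k (F i) t)"
proof -
  have R: "refl_deriv s k (\<lambda>k x. \<Sum>i\<in>S. c i * F i k x) t = (\<Sum>i\<in>S. c i * refl_deriv s k (F i) t)" for k
    unfolding refl_deriv_def
    by (simp add: sum_distrib_left right_diff_distrib sum_subtractf mult_ac)
  have "ext_deriv s k (\<lambda>k x. \<Sum>i\<in>S. c i * F i k x) t
      = (\<Sum>m\<le>k. \<Sum>i\<in>S. c i * (real (k choose m) * bump m t * refl_deriv s (k - m) (F i) t))"
    unfolding ext_deriv_def R by (simp add: sum_distrib_left mult_ac)
  also have "\<dots> = (\<Sum>i\<in>S. c i * ext_deriv s k (F i) t)"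
    unfolding ext_deriv_def by (subst sum.swap) (simp add: sum_distrib_left)
  finally show ?thesis .
qed

lemma ext_gram_quadratic:
  fixes c :: "nat \<Rightarrow> real"
  assumes S: "finite S"
  defines "F \<equiv> \<lambda>k x. \<Sum>i\<in>S. c i * mono_deriv k i x"
  shows "(\<Sum>i\<in>S. \<Sum>j\<in>S. c i * c j * ext_gram k k i j)
       = integral {-1..1} (\<lambda>x. (F k x)\<^sup>2) + (integral {0..1} (\<lambda>t. (ext_deriv 1 k F t)\<^sup>2)
         + integral {0..1} (\<lambda>t. (ext_deriv (-1) k F t)\<^sup>2))"
    and "(\<Sum>i\<in>S. \<Sum>j\<in>S. c i * c j * gram k k i j) = integral {-1..1} (\<lambda>x. (F k x)\<^sup>2)"
proof -
  show 1: "(\<Sum>i\<in>S. \<Sum>j\<in>S. c i * c j * gram k k i j) = integral {-1..1} (\<lambda>x. (F k x)\<^sup>2)"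
    unfolding gram_def F_def by (rule gram_quadratic[OF S continuous_on_mono_deriv])
  have 2: "(\<Sum>i\<in>S. \<Sum>j\<in>S. c i * c j * outer_gram s k k i j) = integral {0..1} (\<lambda>t. (ext_deriv s k F t)\<^sup>2)" for s
    unfolding outer_gram_def F_def ext_deriv_sum
    by (rule gram_quadratic[OF S continuous_on_ext_deriv[OF deriv_seq_mono_deriv]])
  show "(\<Sum>i\<in>S. \<Sum>j\<in>S. c i * c j * ext_gram k k i j)
       = integral {-1..1} (\<lambda>x. (F k x)\<^sup>2) + (integral {0..1} (\<lambda>t. (ext_deriv 1 k F t)\<^sup>2)
         + integral {0..1} (\<lambda>t. (ext_deriv (-1) k F t)\<^sup>2))"
    unfolding ext_gram_def distrib_left sum.distrib 1 2 ..
qed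

abbreviation gram_H2 :: "nat \<Rightarrow> nat \<Rightarrow> real" where
  "gram_H2 i j \<equiv> gram 0 0 i j + gram 1 1 i j + gram 2 2 i j"

text \<open>The interval and its two outer neighbours give \<open>1 + 2 * 82 = 165\<close> and
  \<open>1 + 2 * 9000 = 18001\<close>; the common constant 20000 covers both and does not depend on
  the degree.\<close>

lemma psd_ext_gram_le:
  "psd (\<lambda>i j. 20000 * gram 0 0 i j - ext_gram 0 0 i j)" (is ?A)
  "psd (\<lambda>i j. 20000 * gram_H2 i j - ext_gram 2 2 i j)" (is ?B)
proof -
  have *: "0 \<le> integral {-1..1} (\<lambda>x. (F k x)\<^sup>2)" if "deriv_seq F" for F k
    by (intro integral_nonneg integrable_continuous_interval continuous_intros
        continuous_on_deriv_seq[OF that]) auto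
  have **: "(\<Sum>i\<in>S. \<Sum>j\<in>S. c i * c j * (20000 * K i j - L i j)) =
     20000 * (\<Sum>i\<in>S. \<Sum>j\<in>S. c i * c j * K i j) - (\<Sum>i\<in>S. \<Sum>j\<in>S. c i * c j * L i j)"
    for S :: "nat set" and c :: "nat \<Rightarrow> real" and K L
    by (simp add: sum_distrib_left right_diff_distrib sum_subtractf mult.left_commute)
  have s: "\<bar>1 :: real\<bar> = 1" "\<bar>- 1 :: real\<bar> = 1" by simp_all
  have sq: "deriv_seq (\<lambda>k x. \<Sum>i\<in>S. c i * mono_deriv k i x)" for S :: "nat set" and c :: "nat \<Rightarrow> real"
    by (rule deriv_seq_sum) (rule deriv_seq_mono_deriv)
  show ?A
  proof (rule psdI)
    fix S :: "nat set" and c :: "nat \<Rightarrow> real" assume S: "finite S"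
    note F = sq[where S = S and c = c]
    show "0 \<le> (\<Sum>i\<in>S. \<Sum>j\<in>S. c i * c j * (20000 * gram 0 0 i j - ext_gram 0 0 i j))"
      unfolding ** ext_gram_quadratic[OF S]
      using integral_ext_deriv_0_le[OF F s(1)] integral_ext_deriv_0_le[OF F s(2)] *[OF F, of 0]
      by linarith
  qed
  show ?B
  proof (rule psdI)
    fix S :: "nat set" and c :: "nat \<Rightarrow> real" assume S: "finite S"
    note F = sq[where S = S and c = c]
    show "0 \<le> (\<Sum>i\<in>S. \<Sum>j\<in>S. c i * c j * (20000 * gram_H2 i j - ext_gram 2 2 i j))"
      unfolding ** distrib_left[of "_ * _"] sum.distrib ext_gram_quadratic[OF S]
      using integral_ext_deriv_2_le[OF F s(1)] integral_ext_deriv_2_le[OF F s(2)]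
        *[OF F, of 0] *[OF F, of 1] *[OF F, of 2]
      unfolding distrib_left by linarith
  qed
qed

subsection \<open>Mixed second derivatives\<close>

text \<open>\<open>psd_block_diff\<close> acts as the arithmetic-geometric mean inequality for the product of the two
  pure second derivatives.\<close>

lemma psd_mixed_le_ext:
  fixes f1 f2 :: "'a \<Rightarrow> nat"
  defines "E1 \<equiv> \<lambda>k l p q. ext_gram k l (f1 p) (f1 q)" and "E2 \<equiv> \<lambda>k l p q. ext_gram k l (f2 p) (f2 q)"
  shows "psd (\<lambda>p q. E1 2 2 p q * E2 0 0 p q + E1 0 0 p q * E2 2 2 p q - 2 * (E1 1 1 p q * E2 1 1 p q))"
proof -
  \<comment> \<open>\<open>True\<close> selects two derivatives in the first variable and
    \<open>False\<close> two in the second, so the block difference is the Gram kernel of the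
    difference of the pure second derivatives.\<close>
  define \<kappa> \<kappa>' :: "'a \<times> bool \<Rightarrow> nat"
    where "\<kappa> x = (if snd x then 2 else 0)" and "\<kappa>' x = (if snd x then 0 else 2)" for x
  have "psd (\<lambda>x y. ext_gram (\<kappa> x) (\<kappa> y) (f1 (fst x)) (f1 (fst y))
                 * ext_gram (\<kappa>' x) (\<kappa>' y) (f2 (fst x)) (f2 (fst y)))"
    by (rule psd_multD[OF psd_mult_ext_gram[where \<nu> = "\<lambda>x. f2 (fst x)"]
          psd_mult_imp_psd[OF psd_mult_ext_gram[where \<nu> = "\<lambda>x. f1 (fst x)"]]])
  from psd_block_diff[OF this]
  have "psd (\<lambda>p q. E1 2 2 p q * E2 0 0 p q + E1 0 0 p q * E2 2 2 p q
                 - E1 2 0 p q * E2 0 2 p q - E1 0 2 p q * E2 2 0 p q)"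
    by (simp add: \<kappa>_def \<kappa>'_def E1_def E2_def)
  \<comment> \<open>One integration by parts in each variable; the two minus signs cancel in the
    products \<open>E1 2 0 p q * E2 0 2 p q\<close> and
    \<open>E1 0 2 p q * E2 2 0 p q\<close>.\<close>
  moreover have by_parts: "ext_gram 2 0 i j = - ext_gram 1 1 i j" "ext_gram 0 2 i j = - ext_gram 1 1 i j" for i j
    using ext_gram_by_parts[of i j] ext_gram_by_parts[of j i]
      ext_gram_commute[of 0 2 i j] ext_gram_commute[of 1 1 i j] by simp_all
  ultimately show ?thesis
    by (simp add: E1_def E2_def by_parts)
qed

text \<open>In the extended inequality \<open>A\<close> lies below \<open>E 1\<close>, while
  \<open>E 0\<close> and \<open>E 2\<close> lie below multiples of \<open>G\<close> and
  \<open>H\<close>. One factor is replaced at a time; the other factor, being a multiplier,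
  preserves the order.\<close>

lemma psd_mixed_le:
  fixes f1 f2 :: "'a \<Rightarrow> nat"
  defines "G \<equiv> \<lambda>f p q. gram 0 0 (f p) (f q)" and "A \<equiv> \<lambda>f p q. gram 1 1 (f p) (f q)"
    and "H \<equiv> \<lambda>f p q. gram_H2 (f p) (f q)"
  shows "psd (\<lambda>p q. 20000\<^sup>2 * (H f1 p q * G f2 p q + G f1 p q * H f2 p q) - 2 * (A f1 p q * A f2 p q))"
proof -
  define E where "E k f p q = ext_gram k k (f p) (f q)" for k and f :: "'a \<Rightarrow> nat" and p q
  let ?C = "20000 :: real"
  have mE: "psd_mult (E k f)" for k f
    using psd_mult_ext_gram[of "\<lambda>_. k" f] by (simp add: E_def[abs_def])
  have mG: "psd_mult (\<lambda>p q. gram k k (f p) (f q))" for k and f :: "'a \<Rightarrow> nat"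
    using psd_mult_gram_kernel[of "\<lambda>_. k" f] by simp
  have mH: "psd_mult (H f)" for f
    unfolding H_def by (intro psd_mult_add mG)
  have mA: "psd_mult (A f)" and mG0: "psd_mult (G f)" for f
    unfolding A_def G_def by (rule mG)+
  have le0: "psd (\<lambda>p q. ?C * G f p q - E 0 f p q)"
    and le2: "psd (\<lambda>p q. ?C * H f p q - E 2 f p q)"
    and le1: "psd (\<lambda>p q. E 1 f p q - A f p q)" for f
    using psd_pullback[OF psd_ext_gram_le(1), of f] psd_pullback[OF psd_ext_gram_le(2), of f]
      psd_pullback[OF psd_gram_le_ext_gram[of 1], of f] by (simp_all add: G_def H_def A_def E_def)
  have s1: "psd (\<lambda>p q. E 2 f p q * E 0 g p q + E 0 f p q * E 2 g p q - 2 * (E 1 f p q * E 1 g p q))" for f g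
    unfolding E_def by (rule psd_mixed_le_ext)
  have s2: "psd (\<lambda>p q. 2 * ((E 1 f p q - A f p q) * E 1 g p q + (E 1 g p q - A g p q) * A f p q))" for f g
    by (intro psd_cmult psd_add psd_multD[OF mE le1] psd_multD[OF mA le1]) simp
  have s3: "psd (\<lambda>p q. (?C * H f p q - E 2 f p q) * E 0 g p q + ?C * ((?C * G g p q - E 0 g p q) * H f p q))" for f g
    by (intro psd_cmult psd_add psd_multD[OF mE le2] psd_multD[OF mH le0]) simp
  \<comment> \<open>The sum telescopes: every product containing a kernel \<open>E\<close>
    cancels.\<close>
  have "psd (\<lambda>p q. (E 2 f1 p q * E 0 f2 p q + E 0 f1 p q * E 2 f2 p q - 2 * (E 1 f1 p q * E 1 f2 p q))
     + 2 * ((E 1 f1 p q - A f1 p q) * E 1 f2 p q + (E 1 f2 p q - A f2 p q) * A f1 p q)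
     + ((?C * H f1 p q - E 2 f1 p q) * E 0 f2 p q + ?C * ((?C * G f2 p q - E 0 f2 p q) * H f1 p q))
     + ((?C * H f2 p q - E 2 f2 p q) * E 0 f1 p q + ?C * ((?C * G f1 p q - E 0 f1 p q) * H f2 p q)))"
    (is "psd ?K") by (intro psd_add s1 s2 s3)
  also have "?K = (\<lambda>p q. ?C\<^sup>2 * (H f1 p q * G f2 p q + G f1 p q * H f2 p q) - 2 * (A f1 p q * A f2 p q))"
    by (intro ext) (simp add: power2_eq_square algebra_simps)
  finally show ?thesis .
qed

subsection \<open>Integrals over the cube\<close>

text \<open>Lebesgue measure on \<open>real^'n\<close> is the image of the product measure over
  \<open>Basis\<close>, so Fubini for finite products applies once the factors are indexed by basis
  vectors.\<close>

lemma has_bochner_integral_prod_components: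
  fixes g :: "'n::finite \<Rightarrow> real \<Rightarrow> real"
  assumes g: "\<And>i. integrable lborel (g i)"
  shows "has_bochner_integral lborel (\<lambda>x::real^'n. \<Prod>i\<in>UNIV. g i (x $ i)) (\<Prod>i\<in>UNIV. integral\<^sup>L lborel (g i))"
proof -
  interpret product_sigma_finite "\<lambda>b::real^'n. lborel :: real measure" ..
  define h where "h b = g (THE i. b = axis i (1::real))" for b :: "real^'n"
  have h [simp]: "h (axis i 1) = g i" for i
    by (simp add: h_def axis_eq_axis)
  have [measurable]: "g i \<in> borel_measurable borel" for i
    using g[of i] by (simp add: integrable_iff_bounded)
  have inj: "inj (\<lambda>i::'n. axis i (1::real))" by (auto simp: inj_on_def axis_eq_axis)
  have B: "(Basis :: (real^'n) set) = range (\<lambda>i. axis i 1)"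
    by (auto simp: Basis_vec_def)
  let ?e = "\<lambda>f. \<Sum>b\<in>Basis. f b *\<^sub>R (b :: real^'n)"
  have comp: "?e f $ i = f (axis i 1)" for f i
    by (simp add: cart_eq_inner_axis inner_sum_left inner_Basis if_distrib sum.delta cong: if_cong)
  have prod: "(\<Prod>i\<in>UNIV. g i (?e f $ i)) = (\<Prod>b\<in>Basis. h b (f b))" for f
    unfolding B prod.reindex[OF inj] comp[unfolded B] by simp
  have h_int: "integrable lborel (h b)" if "b \<in> Basis" for b
    using that g unfolding B by auto
  have meas: "(\<lambda>x::real^'n. \<Prod>i\<in>UNIV. g i (x $ i)) \<in> borel_measurable borel" by measurable
  have e: "?e \<in> measurable (\<Pi>\<^sub>M b\<in>Basis. lborel) borel" by measurable
  have "integrable lborel (\<lambda>x::real^'n. \<Prod>i\<in>UNIV. g i (x $ i))"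
    unfolding lborel_eq[where 'a = "real^'n"] integrable_distr_eq[OF e meas] prod
    by (rule product_integrable_prod) (auto intro: h_int)
  moreover have "integral\<^sup>L lborel (\<lambda>x::real^'n. \<Prod>i\<in>UNIV. g i (x $ i)) = (\<Prod>b\<in>Basis. integral\<^sup>L lborel (h b))"
    unfolding lborel_eq[where 'a = "real^'n"] integral_distr[OF e meas] prod
    by (rule product_integral_prod) (auto intro: h_int)
  ultimately show ?thesis
    by (simp add: has_bochner_integral_iff B prod.reindex[OF inj])
qed

text \<open>The indicator of the open cube is the product of indicators of open intervals, and
  passing to closed intervals does not change the integrals.\<close>

lemma has_bochner_integral_Q_prod:
  fixes f :: "3 \<Rightarrow> real \<Rightarrow> real"
  assumes f: "\<And>i. continuous_on {-1..1} (f i)"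
  shows "has_bochner_integral lborel (\<lambda>x. indicator Q x *\<^sub>R (\<Prod>i\<in>UNIV. f i (x $ i)))
           (\<Prod>i\<in>UNIV. integral {-1..1} (f i))"
proof -
  let ?J = "{-1<..<1::real}"
  have f_int: "set_integrable lborel ?J (f i)" for i
    by (rule set_integrable_subset[OF borel_integrable_atLeastAtMost'[OF f]]) auto
  have "(\<Prod>i\<in>UNIV. indicator ?J (x $ i) *\<^sub>R f i (x $ i)) = indicator Q x *\<^sub>R (\<Prod>i\<in>UNIV. f i (x $ i))" for x
  proof (cases "x \<in> Q")
    case False
    then obtain i where "x $ i \<notin> ?J" by (auto simp: Q_def)
    hence "\<exists>i. indicator ?J (x $ i) *\<^sub>R f i (x $ i) = 0"
      by (intro exI[of _ i]) (simp add: indicator_def)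
    with False show ?thesis by (auto intro: prod_zero)
  qed (auto simp: Q_def intro!: prod.cong)
  moreover have "integral\<^sup>L lborel (\<lambda>t. indicator ?J t *\<^sub>R f i t) = integral {-1..1} (f i)" for i
    using set_borel_integral_eq_integral(2)[OF f_int]
    by (simp add: set_lebesgue_integral_def integral_open_interval_real)
  ultimately show ?thesis
    using has_bochner_integral_prod_components[of "\<lambda>i t. indicator ?J t *\<^sub>R f i t"]
      f_int[unfolded set_integrable_def] by simp
qed

section \<open>Derivatives of monomials and their Gram forms on the cube\<close>

definition monom_deriv :: "nat \<times> nat \<times> nat \<Rightarrow> nat \<times> nat \<times> nat \<Rightarrow> real^3 \<Rightarrow> real" where
  "monom_deriv \<alpha> p x = mono_deriv (fst \<alpha>) (fst p) (x $ 1) *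
     mono_deriv (fst (snd \<alpha>)) (fst (snd p)) (x $ 2) * mono_deriv (snd (snd \<alpha>)) (snd (snd p)) (x $ 3)"

definition monom_gram :: "nat \<times> nat \<times> nat \<Rightarrow> nat \<times> nat \<times> nat \<Rightarrow> nat \<times> nat \<times> nat \<Rightarrow> real" where
  "monom_gram \<alpha> p q = gram (fst \<alpha>) (fst \<alpha>) (fst p) (fst q) *
     gram (fst (snd \<alpha>)) (fst (snd \<alpha>)) (fst (snd p)) (fst (snd q)) *
     gram (snd (snd \<alpha>)) (snd (snd \<alpha>)) (snd (snd p)) (snd (snd q))"

lemma prod_3: "prod f (UNIV::3 set) = f 1 * f 2 * (f 3 :: 'a::comm_monoid_mult)"
  unfolding UNIV_3 by (simp add: ac_simps)

lemma has_bochner_integral_monom_deriv: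
  "has_bochner_integral lborel (\<lambda>x. indicator Q x *\<^sub>R (monom_deriv \<alpha> p x * monom_deriv \<alpha> q x)) (monom_gram \<alpha> p q)"
proof -
  let ?f = "\<lambda>k i j t. mono_deriv k i t * mono_deriv k j t"
  define f :: "3 \<Rightarrow> real \<Rightarrow> real" where "f i = (if i = 1 then ?f (fst \<alpha>) (fst p) (fst q)
     else if i = 2 then ?f (fst (snd \<alpha>)) (fst (snd p)) (fst (snd q))
     else ?f (snd (snd \<alpha>)) (snd (snd p)) (snd (snd q)))" for i
  have "has_bochner_integral lborel (\<lambda>x. indicator Q x *\<^sub>R (\<Prod>i\<in>UNIV. f i (x $ i)))
           (\<Prod>i\<in>UNIV. integral {-1..1} (f i))"
    by (rule has_bochner_integral_Q_prod)
       (auto simp: f_def intro!: continuous_intros continuous_on_mono_deriv)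
  also have "(\<lambda>x. indicator Q x *\<^sub>R (\<Prod>i\<in>UNIV. f i (x $ i)))
      = (\<lambda>x. indicator Q x *\<^sub>R (monom_deriv \<alpha> p x * monom_deriv \<alpha> q x))"
    by (intro ext) (simp add: prod_3 f_def monom_deriv_def mult_ac)
  also have "(\<Prod>i\<in>UNIV. integral {-1..1} (f i)) = monom_gram \<alpha> p q"
    by (simp add: prod_3 f_def monom_gram_def gram_def)
  finally show ?thesis .
qed

text \<open>The squared \<open>L^2(Q)\<close> norm of \<open>D \<alpha> u\<close> as a form in the
  coefficients \<open>c\<close> of \<open>u\<close>.\<close>

definition gram_form :: "nat \<times> nat \<times> nat \<Rightarrow> (nat \<times> nat \<times> nat \<Rightarrow> real) \<Rightarrow> (nat \<times> nat \<times> nat) set \<Rightarrow> real" where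
  "gram_form \<alpha> c S = (\<Sum>p\<in>S. \<Sum>q\<in>S. c p * c q * monom_gram \<alpha> p q)"

text \<open>The Bochner formulation also records integrability, so the default value 0 of the
  integral never enters.\<close>

lemma has_bochner_integral_square:
  "has_bochner_integral lborel (\<lambda>x. indicator Q x *\<^sub>R (\<Sum>p\<in>S. c p * monom_deriv \<alpha> p x)\<^sup>2) (gram_form \<alpha> c S)"
proof -
  have "has_bochner_integral lborel (\<lambda>x. \<Sum>p\<in>S. \<Sum>q\<in>S. c p * c q *
      (indicator Q x *\<^sub>R (monom_deriv \<alpha> p x * monom_deriv \<alpha> q x))) (gram_form \<alpha> c S)"
    unfolding gram_form_def
    by (intro has_bochner_integral_sum has_bochner_integral_mult_right has_bochner_integral_monom_deriv)
  also have "(\<lambda>x. \<Sum>p\<in>S. \<Sum>q\<in>S. c p * c q * (indicator Q x *\<^sub>R (monom_deriv \<alpha> p x * monom_deriv \<alpha> q x)))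
     = (\<lambda>x. indicator Q x *\<^sub>R (\<Sum>p\<in>S. c p * monom_deriv \<alpha> p x)\<^sup>2)"
    by (intro ext) (simp add: power2_eq_square sum_product sum_distrib_left mult_ac)
  finally show ?thesis .
qed

text \<open>Moving along one axis changes a single factor of each monomial, so only one entry of the
  order increases.\<close>

lemma partial_sum_monom_deriv:
  "partial 1 (\<lambda>x. \<Sum>p\<in>S. c p * monom_deriv (a1, a2, a3) p x) = (\<lambda>x. \<Sum>p\<in>S. c p * monom_deriv (Suc a1, a2, a3) p x)"
  "partial 2 (\<lambda>x. \<Sum>p\<in>S. c p * monom_deriv (a1, a2, a3) p x) = (\<lambda>x. \<Sum>p\<in>S. c p * monom_deriv (a1, Suc a2, a3) p x)"
  "partial 3 (\<lambda>x. \<Sum>p\<in>S. c p * monom_deriv (a1, a2, a3) p x) = (\<lambda>x. \<Sum>p\<in>S. c p * monom_deriv (a1, a2, Suc a3) p x)"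
proof -
  have D: "((\<lambda>t. mono_deriv k i (y + t)) has_real_derivative mono_deriv (Suc k) i y) (at 0)" for k i y
    using DERIV_shift[of "mono_deriv k i" "mono_deriv (Suc k) i y" 0 y]
      has_derivative_mono_deriv[of k i y] by (simp add: add.commute)
  show "partial 1 (\<lambda>x. \<Sum>p\<in>S. c p * monom_deriv (a1, a2, a3) p x) = (\<lambda>x. \<Sum>p\<in>S. c p * monom_deriv (Suc a1, a2, a3) p x)"
    unfolding partial_def monom_deriv_def
    by (intro ext DERIV_imp_deriv DERIV_sum DERIV_cmult)
       (auto simp: axis_def simp del: mono_deriv.simps intro!: DERIV_cmult_right D)
  show "partial 2 (\<lambda>x. \<Sum>p\<in>S. c p * monom_deriv (a1, a2, a3) p x) = (\<lambda>x. \<Sum>p\<in>S. c p * monom_deriv (a1, Suc a2, a3) p x)"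
    unfolding partial_def monom_deriv_def
    by (intro ext DERIV_imp_deriv DERIV_sum DERIV_cmult)
       (auto simp: axis_def simp del: mono_deriv.simps intro!: DERIV_cmult_right DERIV_cmult D)
  show "partial 3 (\<lambda>x. \<Sum>p\<in>S. c p * monom_deriv (a1, a2, a3) p x) = (\<lambda>x. \<Sum>p\<in>S. c p * monom_deriv (a1, a2, Suc a3) p x)"
    unfolding partial_def monom_deriv_def
    by (intro ext DERIV_imp_deriv DERIV_sum DERIV_cmult)
       (auto simp: axis_def simp del: mono_deriv.simps intro!: DERIV_cmult_right DERIV_cmult D)
qed

lemma D_sum_monom_deriv:
  "D \<alpha> (\<lambda>x. \<Sum>p\<in>S. c p * monom_deriv (0, 0, 0) p x) = (\<lambda>x. \<Sum>p\<in>S. c p * monom_deriv \<alpha> p x)"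
proof -
  obtain a1 a2 a3 where \<alpha>: "\<alpha> = (a1, a2, a3)" by (cases \<alpha>)
  let ?U = "\<lambda>a1 a2 a3 x. \<Sum>p\<in>S. c p * monom_deriv (a1, a2, a3) p x"
  have "(partial 3 ^^ n) (?U 0 0 0) = ?U 0 0 n" for n
    by (induction n) (simp_all add: partial_sum_monom_deriv)
  moreover have "(partial 2 ^^ n) (?U 0 0 a3) = ?U 0 n a3" for n
    by (induction n) (simp_all add: partial_sum_monom_deriv)
  moreover have "(partial 1 ^^ n) (?U 0 a2 a3) = ?U n a2 a3" for n
    by (induction n) (simp_all add: partial_sum_monom_deriv)
  ultimately show ?thesis by (simp add: D_def \<alpha>)
qed

text \<open>The first seven indices are those of \<open>form_C\<close>, the last three are the mixed
  ones.\<close>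

lemma multi_indices_le_2:
  "multi_indices_le 2 = {(0,0,0), (1,0,0), (0,1,0), (0,0,1), (2,0,0), (0,2,0), (0,0,2),
     (1,1,0), (1,0,1), (0,1,1)}"
proof (rule set_eqI)
  fix x :: "nat \<times> nat \<times> nat"
  obtain a b c where x: "x = (a, b, c)" by (cases x)
  have "a + b + c \<le> 2 \<longleftrightarrow> (a = 0 \<and> b = 0 \<and> c = 0) \<or> (a = 1 \<and> b = 0 \<and> c = 0)
     \<or> (a = 0 \<and> b = 1 \<and> c = 0) \<or> (a = 0 \<and> b = 0 \<and> c = 1) \<or> (a = 2 \<and> b = 0 \<and> c = 0)
     \<or> (a = 0 \<and> b = 2 \<and> c = 0) \<or> (a = 0 \<and> b = 0 \<and> c = 2) \<or> (a = 1 \<and> b = 1 \<and> c = 0)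
     \<or> (a = 1 \<and> b = 0 \<and> c = 1) \<or> (a = 0 \<and> b = 1 \<and> c = 1)"
    by presburger
  thus "x \<in> multi_indices_le 2 \<longleftrightarrow> x \<in> {(0,0,0), (1,0,0), (0,1,0), (0,0,1), (2,0,0), (0,2,0), (0,0,2),
     (1,1,0), (1,0,1), (0,1,1)}"
    by (simp only: x multi_indices_le_def mem_Collect_eq case_prod_conv insert_iff empty_iff prod.inject simp_thms)
qed

lemma form_B_eq:
  "form_B (\<lambda>x. \<Sum>p\<in>S. c p * monom_deriv (0, 0, 0) p x) = (\<Sum>\<alpha>\<in>multi_indices_le 2. gram_form \<alpha> c S)"
proof -
  have "has_bochner_integral lborel (\<lambda>x. \<Sum>\<alpha>\<in>multi_indices_le 2.
       indicator Q x *\<^sub>R (\<Sum>p\<in>S. c p * monom_deriv \<alpha> p x)\<^sup>2) (\<Sum>\<alpha>\<in>multi_indices_le 2. gram_form \<alpha> c S)"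
    by (intro has_bochner_integral_sum has_bochner_integral_square)
  thus ?thesis
    by (simp add: form_B_def set_lebesgue_integral_def D_sum_monom_deriv sum_distrib_left
        has_bochner_integral_integral_eq)
qed

lemma form_C_eq:
  "form_C (\<lambda>x. \<Sum>p\<in>S. c p * monom_deriv (0, 0, 0) p x) =
     gram_form (2,0,0) c S + gram_form (0,2,0) c S + gram_form (0,0,2) c S
   + gram_form (1,0,0) c S + gram_form (0,1,0) c S + gram_form (0,0,1) c S + gram_form (0,0,0) c S"
proof -
  let ?g = "\<lambda>\<alpha> x. indicator Q x *\<^sub>R (\<Sum>p\<in>S. c p * monom_deriv \<alpha> p x)\<^sup>2"
  have "has_bochner_integral lborel (\<lambda>x. ?g (2,0,0) x + ?g (0,2,0) x + ?g (0,0,2) x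
      + ?g (1,0,0) x + ?g (0,1,0) x + ?g (0,0,1) x + ?g (0,0,0) x)
    (gram_form (2,0,0) c S + gram_form (0,2,0) c S + gram_form (0,0,2) c S
   + gram_form (1,0,0) c S + gram_form (0,1,0) c S + gram_form (0,0,1) c S + gram_form (0,0,0) c S)"
    by (intro has_bochner_integral_add has_bochner_integral_square)
  thus ?thesis
    by (simp add: form_C_def set_lebesgue_integral_def partial_sum_monom_deriv distrib_left
        has_bochner_integral_integral_eq numeral_2_eq_2)
qed

section \<open>Comparison of the two quadratic forms\<close>

lemma gram_form_nonneg: "0 \<le> gram_form \<alpha> c S"
  unfolding has_bochner_integral_square[THEN has_bochner_integral_integral_eq, symmetric]
  by (rule integral_nonneg_AE) simp

lemma quadratic_form_comb:
  fixes c :: "'a \<Rightarrow> real"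
  shows "(\<Sum>p\<in>S. \<Sum>q\<in>S. c p * c q * (a * K p q - b * L p q))
       = a * (\<Sum>p\<in>S. \<Sum>q\<in>S. c p * c q * K p q) - b * (\<Sum>p\<in>S. \<Sum>q\<in>S. c p * c q * L p q)"
  by (simp add: sum_distrib_left right_diff_distrib sum_subtractf mult.left_commute)

text \<open>The two-variable estimate is multiplied by the \<open>L^2\<close> Gram kernel of the
  remaining variable. Each \<open>gram_H2\<close> also contributes its zeroth-order term, hence the
  factor 2 at \<open>gram_form (0,0,0) c S\<close>.\<close>

lemma gram_form_mixed_le:
  assumes "finite S"
  shows "2 * gram_form (1,1,0) c S \<le> 20000\<^sup>2 * (gram_form (2,0,0) c S + gram_form (0,2,0) c S
           + gram_form (1,0,0) c S + gram_form (0,1,0) c S + 2 * gram_form (0,0,0) c S)"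
    and "2 * gram_form (1,0,1) c S \<le> 20000\<^sup>2 * (gram_form (2,0,0) c S + gram_form (0,0,2) c S
           + gram_form (1,0,0) c S + gram_form (0,0,1) c S + 2 * gram_form (0,0,0) c S)"
    and "2 * gram_form (0,1,1) c S \<le> 20000\<^sup>2 * (gram_form (0,2,0) c S + gram_form (0,0,2) c S
           + gram_form (0,1,0) c S + gram_form (0,0,1) c S + 2 * gram_form (0,0,0) c S)"
proof -
  define \<pi>2 \<pi>3 :: "nat \<times> nat \<times> nat \<Rightarrow> nat" where "\<pi>2 p = fst (snd p)" and "\<pi>3 p = snd (snd p)" for p
  have *: "0 \<le> (\<Sum>p\<in>S. \<Sum>q\<in>S. c p * c q *
     ((20000\<^sup>2 * (gram_H2 (f1 p) (f1 q) * gram 0 0 (f2 p) (f2 q) + gram 0 0 (f1 p) (f1 q) * gram_H2 (f2 p) (f2 q))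
       - 2 * (gram 1 1 (f1 p) (f1 q) * gram 1 1 (f2 p) (f2 q))) * gram 0 0 (f3 p) (f3 q)))"
    for f1 f2 f3
    by (rule psdD[OF psd_multD[OF psd_mult_gram_kernel[of "\<lambda>_. 0"] psd_mixed_le] assms])
  \<comment> \<open>The three cases differ only in which projections give the two differentiated
    variables; the premise is the corresponding identity of kernels.\<close>
  have comb: "2 * gram_form \<mu> c S \<le> 20000\<^sup>2 * (gram_form \<alpha> c S + gram_form \<beta> c S
      + gram_form \<gamma> c S + gram_form \<delta> c S + 2 * gram_form (0,0,0) c S)"
    if "\<And>p q. (20000\<^sup>2 * (gram_H2 (f1 p) (f1 q) * gram 0 0 (f2 p) (f2 q) + gram 0 0 (f1 p) (f1 q) * gram_H2 (f2 p) (f2 q))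
         - 2 * (gram 1 1 (f1 p) (f1 q) * gram 1 1 (f2 p) (f2 q))) * gram 0 0 (f3 p) (f3 q)
       = 20000\<^sup>2 * (monom_gram \<alpha> p q + monom_gram \<beta> p q + monom_gram \<gamma> p q + monom_gram \<delta> p q
           + (monom_gram (0,0,0) p q + monom_gram (0,0,0) p q)) - 2 * monom_gram \<mu> p q"
    for \<mu> \<alpha> \<beta> \<gamma> \<delta> f1 f2 f3
    using *[of f1 f2 f3]
    unfolding that quadratic_form_comb distrib_left[of "_ * _"] sum.distrib
    by (simp add: gram_form_def)
  show "2 * gram_form (1,1,0) c S \<le> 20000\<^sup>2 * (gram_form (2,0,0) c S + gram_form (0,2,0) c S
           + gram_form (1,0,0) c S + gram_form (0,1,0) c S + 2 * gram_form (0,0,0) c S)"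
    by (rule comb[of fst \<pi>2 \<pi>3]) (simp add: monom_gram_def \<pi>2_def \<pi>3_def algebra_simps)
  show "2 * gram_form (1,0,1) c S \<le> 20000\<^sup>2 * (gram_form (2,0,0) c S + gram_form (0,0,2) c S
           + gram_form (1,0,0) c S + gram_form (0,0,1) c S + 2 * gram_form (0,0,0) c S)"
    by (rule comb[of fst \<pi>3 \<pi>2]) (simp add: monom_gram_def \<pi>2_def \<pi>3_def algebra_simps)
  show "2 * gram_form (0,1,1) c S \<le> 20000\<^sup>2 * (gram_form (0,2,0) c S + gram_form (0,0,2) c S
           + gram_form (0,1,0) c S + gram_form (0,0,1) c S + 2 * gram_form (0,0,0) c S)"
    by (rule comb[of \<pi>2 \<pi>3 fst]) (simp add: monom_gram_def \<pi>2_def \<pi>3_def algebra_simps)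
qed

text \<open>Only finiteness of the index set is passed on, not \<open>W\<close>, so later constants
  cannot depend on the degree.\<close>

lemma poly_deg_leE:
  assumes "poly_deg_le W u"
  obtains c S where "finite S" "u = (\<lambda>x. \<Sum>p\<in>S. c p * monom_deriv (0, 0, 0) p x)"
proof -
  from assms obtain c where c: "\<And>x. u x =
      (\<Sum>i\<le>W. \<Sum>j\<le>W. \<Sum>k\<le>W. c i j k * (x $ 1) ^ i * (x $ 2) ^ j * (x $ 3) ^ k)"
    unfolding poly_deg_le_def by blast
  show ?thesis
  proof (rule that)
    show "finite ({..W} \<times> {..W} \<times> {..W})" by simp
    show "u = (\<lambda>x. \<Sum>p\<in>{..W} \<times> {..W} \<times> {..W}.
        (case p of (i, j, k) \<Rightarrow> c i j k) * monom_deriv (0, 0, 0) p x)"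
      by (intro ext)
         (simp add: c sum.cartesian_product' monom_deriv_def mult.assoc)
  qed
qed

theorem theorem5p2p1:
  shows "\<exists>c1 > 0. \<exists>c2 > 0. \<forall>W. \<forall>u. poly_deg_le W u \<longrightarrow>
           c1 * form_B u \<le> form_C u \<and> form_C u \<le> c2 * form_B u"
proof (intro exI conjI allI impI)
  \<comment> \<open>Half the sum of the three mixed estimates contains each first-order and pure
    second-order form once and the zeroth-order form three times, hence \<open>3 * 20000^2\<close>;
    the summand 1 accounts for \<open>form_C u\<close> itself.\<close>
  let ?M = "1 + 3 * (20000::real)\<^sup>2"
  show "0 < 1 / ?M" "(0::real) < 1" by simp_all
  fix W u assume "poly_deg_le W u"
  then obtain c S where S: "finite S" and u: "u = (\<lambda>x. \<Sum>p\<in>S. c p * monom_deriv (0, 0, 0) p x)"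
    by (rule poly_deg_leE)
  have B: "form_B u = form_C u + (gram_form (1,1,0) c S + gram_form (1,0,1) c S + gram_form (0,1,1) c S)"
    unfolding u form_B_eq form_C_eq multi_indices_le_2 by simp
  note nonneg = gram_form_nonneg[where c = c and S = S]
  show "form_C u \<le> 1 * form_B u"
    using nonneg[of "(1,1,0)"] nonneg[of "(1,0,1)"] nonneg[of "(0,1,1)"] unfolding B by simp
  have "form_B u \<le> ?M * form_C u"
    using gram_form_mixed_le[OF S, where c = c] nonneg[of "(2,0,0)"] nonneg[of "(0,2,0)"] nonneg[of "(0,0,2)"]
      nonneg[of "(1,0,0)"] nonneg[of "(0,1,0)"] nonneg[of "(0,0,1)"] nonneg[of "(0,0,0)"]
    unfolding B unfolding u form_C_eq by simp
  thus "1 / ?M * form_B u \<le> form_C u" by (simp add: field_simps)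
qed

end
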